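(* Let $\mathcal T\subseteq M_n(\mathbb C)$ be the subspace of all $n\times n$ Toeplitz matrices. If $\varphi:\mathcal T\to M_n(\mathbb C)$ is a linear isometry, then there are unitaries $U,V\in M_n(\mathbb C)$ such that $\varphi(T)=UTV$ for every $T\in\mathcal T$.
   Context: An $n\times n$ Toeplitz matrix is a matrix $(t_{ij})$ whose entries depend only on $i-j$. $M_n(\mathbb C)$ carries the operator norm induced by the Euclidean norm on $\mathbb C^n$; a linear isometry is a linear map with $\|\varphi(T)\|=\|T\|$ for all $T$. *)

theory Defs
  imports "HOL-Analysis.Analysis"
begin

text \<open>n x n complex matrices are complex^'n^'n for a finite index type 'n with a
linear order; the k-th index (0-based) is the element of rank k.\<close>

definition idx_rank :: "'n::{finite,linorder} \<Rightarrow> nat" where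
  "idx_rank i = card {j. j < i}"

definition toeplitz :: "complex^('n::{finite,linorder})^('n::{finite,linorder}) \<Rightarrow> bool" where
  "toeplitz T \<longleftrightarrow> (\<forall>i j k l.
     int (idx_rank i) - int (idx_rank j) = int (idx_rank k) - int (idx_rank l)
     \<longrightarrow> T$i$j = T$k$l)"

definition opnorm :: "complex^('n::finite)^('m::finite) \<Rightarrow> real" where
  "opnorm A = onorm (\<lambda>x::complex^'n. A *v x)"

definition cmat_scale :: "complex \<Rightarrow> complex^'n^'m \<Rightarrow> complex^'n^'m" where
  "cmat_scale c A = (\<chi> i j. c * A$i$j)"

definition adjoint_mat :: "complex^'n^'m \<Rightarrow> complex^'m^'n" where
  "adjoint_mat A = (\<chi> i j. cnj (A$j$i))"

definition unitary_mat :: "complex^('n::finite)^('n::finite) \<Rightarrow> bool" where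
  "unitary_mat U \<longleftrightarrow> U ** adjoint_mat U = mat 1 \<and> adjoint_mat U ** U = mat 1"

end

theory Submission
  imports Defs
begin

text \<open>
For |z| = 1 the generalized circulant matrices attached to z, i.e. the matrices diagonalized by the
n vectors with entries w^(-j), where w^n = z^n, are Toeplitz and form a copy of the C*-algebra of
diagonal matrices. A family E_1, ..., E_n in M_n spanning an isometric copy of the sup norm space
is, up to unitaries on both sides, the family of diagonal matrix units: if E_m attains its norm at
x_m, the parallelogram law forces the other E_k to vanish at x_m, and dually for the adjoints. Hence
after multiplication by the adjoint of the unitary \<phi>(1), \<phi> is a *-homomorphism \<psi> on every circulant
algebra. Comparing coefficients in l = z^n in the powers of S + l (S*)^(n-1), where S is the shift,
yields \<psi>(S^k) = A^k and \<psi>((S*)^k) = (A*)^k for A = \<psi>(S), with A^n = 0. As the norm of A^(n-1) is 1,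
there is a unit vector x such that x, A x, ..., A^(n-1) x are unit vectors; they are orthogonal since
A^n = 0, so A is unitarily equivalent to S.
\<close>

subsection \<open>Complex matrices and the operator norm\<close>

text \<open>Conjugate linear in the first argument. The real inner product \<open>\<bullet>\<close>
  is only its real part, while unitarity of a matrix needs the full complex value to vanish for
  distinct columns.\<close>

definition cip :: "complex^'n \<Rightarrow> complex^'n \<Rightarrow> complex" where
  "cip x y = (\<Sum>i\<in>UNIV. cnj (x$i) * y$i)"

definition cdiag :: "('n \<Rightarrow> complex) \<Rightarrow> complex^'n^'n" where
  "cdiag c = (\<chi> i j. if i = j then c i else 0)"

lemma inner_eq_Re_cip: "x \<bullet> y = Re (cip x y)"
  by (simp add: inner_vec_def cip_def inner_complex_def)

lemma cip_self: "cip x x = of_real ((norm x)\<^sup>2)"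
proof (rule complex_eqI)
  show "Re (cip x x) = Re (of_real ((norm x)\<^sup>2))"
    by (simp add: inner_eq_Re_cip[symmetric] power2_norm_eq_inner)
  show "Im (cip x x) = Im (of_real ((norm x)\<^sup>2))"
    by (simp add: cip_def mult.commute)
qed

lemma cip_commute: "cip x y = cnj (cip y x)"
  by (simp add: cip_def mult.commute)

lemma cip_adjoint: "cip (A *v x) y = cip x (adjoint_mat A *v y)"
proof -
  have "cip (A *v x) y = (\<Sum>i\<in>UNIV. \<Sum>j\<in>UNIV. cnj (A$i$j) * cnj (x$j) * y$i)"
    by (simp add: cip_def matrix_vector_mult_def sum_distrib_right)
  also have "\<dots> = (\<Sum>j\<in>UNIV. \<Sum>i\<in>UNIV. cnj (A$i$j) * cnj (x$j) * y$i)"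
    by (rule sum.swap)
  also have "\<dots> = cip x (adjoint_mat A *v y)"
    by (simp add: cip_def matrix_vector_mult_def adjoint_mat_def sum_distrib_left mult_ac)
  finally show ?thesis .
qed

lemma inner_adjoint: "(A *v x) \<bullet> y = x \<bullet> (adjoint_mat A *v y)"
  for A :: "complex^'n^'m"
  by (simp add: inner_eq_Re_cip cip_adjoint)

lemma adjoint_mat_adjoint [simp]: "adjoint_mat (adjoint_mat A) = A"
  by (simp add: adjoint_mat_def vec_eq_iff)

lemma adjoint_mat_mult: "adjoint_mat (A ** B) = adjoint_mat B ** adjoint_mat A"
  by (simp add: adjoint_mat_def matrix_matrix_mult_def vec_eq_iff mult.commute)

lemma adjoint_mat_add: "adjoint_mat (A + B) = adjoint_mat A + adjoint_mat B"
  by (simp add: adjoint_mat_def vec_eq_iff)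

lemma adjoint_mat_scale: "adjoint_mat (cmat_scale c A) = cmat_scale (cnj c) (adjoint_mat A)"
  by (simp add: adjoint_mat_def cmat_scale_def vec_eq_iff)

lemma adjoint_mat_cdiag: "adjoint_mat (cdiag c) = cdiag (\<lambda>i. cnj (c i))"
  by (simp add: adjoint_mat_def cdiag_def vec_eq_iff)

lemma cdiag_1: "cdiag (\<lambda>_. 1) = mat 1"
  by (simp add: mat_def cdiag_def vec_eq_iff)

lemma mult_cdiag_entry:
  "(A ** cdiag c ** B)$i$j = (\<Sum>m\<in>UNIV. A$i$m * c m * B$m$j)"
  by (simp add: matrix_matrix_mult_def cdiag_def if_distrib[of "\<lambda>x. _ * x"] sum.delta cong: if_cong)

lemma cdiag_mult: "cdiag c ** cdiag d = cdiag (\<lambda>i. c i * d i)"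
  by (simp add: matrix_matrix_mult_def cdiag_def vec_eq_iff if_distrib[of "\<lambda>x. x * _"]
      if_distrib[of "\<lambda>x. _ * x"] sum.delta cong: if_cong)

lemma mult_cdiag_add:
  "A ** cdiag (\<lambda>i. c i + d i) ** B = A ** cdiag c ** B + A ** cdiag d ** B"
  by (simp add: vec_eq_iff mult_cdiag_entry algebra_simps sum.distrib)

lemma mult_cdiag_scale:
  "A ** cdiag (\<lambda>i. a * c i) ** B = cmat_scale a (A ** cdiag c ** B)"
  by (simp add: vec_eq_iff mult_cdiag_entry cmat_scale_def sum_distrib_left mult_ac)

text \<open>The outer factors are unrelated because this serves twice: to split a circulant into its
  spectral projections, and to reassemble their images under \<open>\<phi>\<close>.\<close>

lemma mult_cdiag_expand:
  "A ** cdiag c ** B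
    = (\<Sum>m\<in>UNIV. cmat_scale (c m) (A ** cdiag (\<lambda>j. if j = m then 1 else 0) ** B))"
  by (simp add: vec_eq_iff mult_cdiag_entry cmat_scale_def if_distrib[of "\<lambda>x. _ * x"]
      if_distrib[of "\<lambda>x. x * _"] sum.delta mult_ac cong: if_cong)

lemma cdiag_vec: "cdiag c *v x = (\<chi> i. c i * x$i)"
  by (simp add: matrix_vector_mult_def cdiag_def vec_eq_iff if_distrib[of "\<lambda>x. x * _"]
      sum.delta cong: if_cong)

lemma matrix_add_rdistrib: "(A + B) ** C = A ** C + B ** C"
  by (simp add: matrix_matrix_mult_def vec_eq_iff algebra_simps sum.distrib)

lemma matrix_scale_left: "cmat_scale c A ** B = cmat_scale c (A ** B)"
  by (simp add: cmat_scale_def matrix_matrix_mult_def vec_eq_iff sum_distrib_left mult_ac)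

lemma matrix_scale_right: "A ** cmat_scale c B = cmat_scale c (A ** B)"
  by (simp add: cmat_scale_def matrix_matrix_mult_def vec_eq_iff sum_distrib_left mult_ac)

lemma matrix_scale_vec: "cmat_scale c A *v x = c *s (A *v x)"
  by (simp add: cmat_scale_def matrix_vector_mult_def vec_eq_iff sum_distrib_left mult_ac)

section \<open>The operator norm and unitaries\<close>

lemma norm_mult_vec_le: "norm (A *v x) \<le> opnorm A * norm x"
  for A :: "complex^'n^'m"
  unfolding opnorm_def by (rule onorm) simp

lemma opnorm_bound: "0 \<le> b \<Longrightarrow> (\<And>x. norm (A *v x) \<le> b * norm x) \<Longrightarrow> opnorm A \<le> b"
  unfolding opnorm_def by (rule onorm_bound)

lemma opnorm_attained:
  fixes A :: "complex^'n^'m"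
  obtains x where "norm x = 1" "norm (A *v x) = opnorm A"
proof -
  have "compact (sphere (0::complex^'n) 1)" by simp
  moreover have "axis undefined 1 \<in> sphere (0::complex^'n) 1" by simp
  moreover have "continuous_on (sphere (0::complex^'n) 1) (\<lambda>x. norm (A *v x))"
    by (intro continuous_on_norm linear_continuous_on) simp
  ultimately obtain x where x: "norm x = 1"
    and max: "\<And>y. norm y = 1 \<Longrightarrow> norm (A *v y) \<le> norm (A *v x)"
    using continuous_attains_sup[of "sphere (0::complex^'n) 1" "\<lambda>x. norm (A *v x)"]
    by (auto simp: dist_norm)
  have lin: "linear ((*v) A)" by simp
  have "opnorm A \<le> norm (A *v x)"
  proof (rule opnorm_bound)
    fix y
    show "norm (A *v y) \<le> norm (A *v x) * norm y"
    proof (cases "y = 0")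
      case False
      then have "norm (A *v (inverse (norm y) *\<^sub>R y)) \<le> norm (A *v x)"
        by (intro max) simp
      then have "inverse (norm y) * norm (A *v y) \<le> norm (A *v x)"
        by (simp add: linear_cmul[OF lin])
      with False show ?thesis by (simp add: field_simps)
    qed simp
  qed simp
  with norm_mult_vec_le[of A x] x that[of x] show ?thesis by simp
qed

lemma opnorm_adjoint_le: "opnorm (adjoint_mat A) \<le> opnorm A"
  for A :: "complex^'n^'m"
proof -
  have A0: "0 \<le> opnorm A"
    by (metis norm_ge_zero opnorm_attained)
  then show ?thesis
  proof (rule opnorm_bound)
    fix y
    let ?z = "adjoint_mat A *v y"
    \<comment> \<open>The square of the norm of A* y is the inner product of A A* y with y;
      Cauchy-Schwarz leaves one factor \<open>norm ?z\<close> to cancel.\<close>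
    have "norm ?z * norm ?z = (A *v ?z) \<bullet> y"
      using inner_adjoint[of A ?z y] by (simp add: dot_square_norm power2_eq_square)
    also have "\<dots> \<le> norm (A *v ?z) * norm y"
      by (rule norm_cauchy_schwarz)
    also have "\<dots> \<le> opnorm A * norm ?z * norm y"
      by (intro mult_right_mono norm_mult_vec_le) simp
    finally have "norm ?z * norm ?z \<le> norm ?z * (opnorm A * norm y)"
      by (simp add: mult_ac)
    then show "norm ?z \<le> opnorm A * norm y"
      using A0 by (cases "norm ?z = 0") (auto simp: mult_le_cancel_left)
  qed
qed

lemma unitary_adjoint: "unitary_mat U \<Longrightarrow> unitary_mat (adjoint_mat U)"
  by (simp add: unitary_mat_def)

lemma unitary_mult: "unitary_mat U \<Longrightarrow> unitary_mat V \<Longrightarrow> unitary_mat (U ** V)"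
  unfolding unitary_mat_def adjoint_mat_mult
  by (metis matrix_mul_assoc matrix_mul_rid)

lemma norm_unitary:
  assumes "unitary_mat U"
  shows "norm (U *v x) = norm x"
proof -
  have "(U *v x) \<bullet> (U *v x) = x \<bullet> ((adjoint_mat U ** U) *v x)"
    by (simp add: inner_adjoint matrix_vector_mul_assoc)
  with assms show ?thesis by (simp add: unitary_mat_def norm_eq_sqrt_inner)
qed

lemma column_mult: "column j (A ** B) = A *v column j B"
  by (simp add: column_def matrix_matrix_mult_def matrix_vector_mult_def vec_eq_iff)

lemma matrix_eq_columns: "(\<And>j. column j A = column j B) \<Longrightarrow> A = B"
  by (simp add: column_def vec_eq_iff)

lemma unitary_columns:
  fixes U :: "complex^'n^'n"
  assumes "\<And>j. norm (column j U) = 1" "\<And>i j. i \<noteq> j \<Longrightarrow> cip (column i U) (column j U) = 0"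
  shows "unitary_mat U"
proof -
  have "(adjoint_mat U ** U)$i$j = cip (column i U) (column j U)" for i j
    by (simp add: adjoint_mat_def matrix_matrix_mult_def cip_def column_def)
  then have "adjoint_mat U ** U = mat 1"
    using assms by (auto simp: vec_eq_iff mat_def cip_self)
  then show ?thesis
    by (simp add: unitary_mat_def matrix_left_right_inverse)
qed

lemma opnorm_conj_cdiag_le:
  assumes X: "unitary_mat X" and c: "\<And>i. cmod (c i) \<le> 1"
  shows "opnorm (X ** cdiag c ** adjoint_mat X) \<le> 1"
proof (rule opnorm_bound)
  fix x
  let ?y = "adjoint_mat X *v x"
  have "norm ((X ** cdiag c ** adjoint_mat X) *v x) = norm (cdiag c *v ?y)"
    by (simp add: matrix_vector_mul_assoc[symmetric] norm_unitary[OF X])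
  also have "\<dots> \<le> norm ?y"
    using c by (intro norm_le_componentwise_cart) (simp add: cdiag_vec norm_mult mult_left_le_one_le)
  also have "\<dots> = norm x"
    by (intro norm_unitary unitary_adjoint X)
  finally show "norm ((X ** cdiag c ** adjoint_mat X) *v x) \<le> 1 * norm x" by simp
qed simp

lemma opnorm_conj_cdiag_unit:
  fixes X :: "complex^'n^'n"
  assumes X: "unitary_mat X"
  shows "opnorm (X ** cdiag (\<lambda>j. if j = i then 1 else 0) ** adjoint_mat X) = 1"
    (is "opnorm (X ** cdiag ?d ** _) = 1")
proof (rule antisym)
  let ?e = "axis i 1 :: complex^'n"
  have "adjoint_mat X ** X = mat 1"
    using X by (simp add: unitary_mat_def)
  \<comment> \<open>The unit vector X e_i turns out to be fixed, which bounds the norm from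
    below.\<close>
  then have "(X ** cdiag ?d ** adjoint_mat X) *v (X *v ?e) = X *v (cdiag ?d *v ?e)"
    by (metis matrix_mul_assoc matrix_mul_rid matrix_vector_mul_assoc)
  moreover have "cdiag ?d *v ?e = ?e"
    by (simp add: cdiag_vec axis_def vec_eq_iff)
  ultimately show "1 \<le> opnorm (X ** cdiag ?d ** adjoint_mat X)"
    using norm_mult_vec_le[of "X ** cdiag ?d ** adjoint_mat X" "X *v ?e"]
    by (simp add: norm_unitary[OF X])
  show "opnorm (X ** cdiag ?d ** adjoint_mat X) \<le> 1"
    by (rule opnorm_conj_cdiag_le[OF X]) simp
qed

section \<open>Isometric copies of the sup norm space\<close>

lemma zero_of_norm_add_diff_le_1:
  fixes a b :: "'a::real_inner"
  assumes "norm a = 1" "norm (a + b) \<le> 1" "norm (a - b) \<le> 1"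
  shows "b = 0"
proof -
  have "(norm (a + b))\<^sup>2 + (norm (a - b))\<^sup>2 = 2 * (norm a)\<^sup>2 + 2 * (norm b)\<^sup>2"
    by (simp add: power2_norm_eq_inner algebra_simps inner_commute)
  moreover have "(norm (a + b))\<^sup>2 \<le> 1" "(norm (a - b))\<^sup>2 \<le> 1"
    using assms by (simp_all add: power_le_one)
  moreover have "(norm a)\<^sup>2 = 1" using assms(1) by simp
  ultimately have "(norm b)\<^sup>2 \<le> 0" by linarith
  then show ?thesis by simp
qed

text \<open>The equality case of Cauchy-Schwarz: z = A* A x has norm at most 1 and inner product |A
  x|^2 = 1 with the unit vector x, so |z - x|^2 is at most 1 - 2 + 1 = 0.\<close>

lemma adjoint_of_norm_attained:
  fixes A :: "complex^'n^'m"
  assumes A: "opnorm A \<le> 1" and x: "norm x = 1" and Ax: "norm (A *v x) = 1"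
  shows "adjoint_mat A *v (A *v x) = x"
proof -
  let ?z = "adjoint_mat A *v (A *v x)"
  have "norm ?z \<le> opnorm (adjoint_mat A) * norm (A *v x)"
    by (rule norm_mult_vec_le)
  also have "\<dots> \<le> 1"
    using opnorm_adjoint_le[of A] A by (simp add: Ax)
  finally have "?z \<bullet> ?z \<le> 1"
    by (simp add: norm_le_square)
  moreover have "x \<bullet> ?z = 1"
    using Ax by (simp add: inner_adjoint[symmetric] norm_eq_1)
  moreover have "x \<bullet> x = 1"
    using x by (simp add: norm_eq_1)
  ultimately have "(?z - x) \<bullet> (?z - x) \<le> 0"
    by (simp add: inner_diff inner_commute)
  then show ?thesis
    by (metis inner_eq_zero_iff inner_ge_zero order_antisym right_minus_eq)
qed

text \<open>Take unit vectors x_m at which E_m attains its norm and put y_m = E_m x_m. For k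
  distinct from m the bounds force E_k x_m = 0 and E_k* y_m = 0. Hence both families are
  orthonormal, and they form the columns of X and Y.\<close>

lemma isometric_linfty_in_matrices:
  fixes E :: "'n::finite \<Rightarrow> complex^'n^'n"
  assumes E1: "\<And>m. opnorm (E m) = 1"
    and plus: "\<And>m k. m \<noteq> k \<Longrightarrow> opnorm (E m + E k) \<le> 1"
    and minus: "\<And>m k. m \<noteq> k \<Longrightarrow> opnorm (E m - E k) \<le> 1"
  obtains X Y where "unitary_mat X" "unitary_mat Y"
    "\<And>m. E m = Y ** cdiag (\<lambda>j. if j = m then 1 else 0) ** adjoint_mat X"
proof -
  have "\<forall>m. \<exists>x. norm x = 1 \<and> norm (E m *v x) = 1"
    by (metis E1 opnorm_attained)
  then obtain x where nx: "\<And>m. norm (x m) = 1" and nEx: "\<And>m. norm (E m *v x m) = 1"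
    by metis
  define y where "y m = E m *v x m" for m
  have ny: "norm (y m) = 1" for m
    by (simp add: y_def nEx)
  \<comment> \<open>Stated for an arbitrary family \<open>F\<close>, so that it serves the
    \<open>E m\<close> and also their adjoints.\<close>
  have kill: "F k *v u = 0"
    if "m \<noteq> k" "norm u = 1" "norm (F m *v u) = 1"
      "opnorm (F m + F k) \<le> 1" "opnorm (F m - F k) \<le> 1"
    for F :: "'n \<Rightarrow> complex^'n^'n" and m k u
  proof (rule zero_of_norm_add_diff_le_1[OF that(3)])
    show "norm (F m *v u + F k *v u) \<le> 1"
      using norm_mult_vec_le[of "F m + F k" u] that by (simp add: matrix_vector_mult_add_rdistrib)
    show "norm (F m *v u - F k *v u) \<le> 1"
      using norm_mult_vec_le[of "F m - F k" u] that by (simp add: matrix_vector_mult_diff_rdistrib)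
  qed
  have Ex: "E k *v x m = 0" if "m \<noteq> k" for m k
    using kill[OF that, of "x m" E] nx nEx plus[OF that] minus[OF that] by simp
  have Estar: "adjoint_mat (E m) *v y m = x m" for m
    unfolding y_def by (intro adjoint_of_norm_attained) (simp_all add: E1 nx nEx)
  have adj_diff: "adjoint_mat A - adjoint_mat B = adjoint_mat (A - B)" for A B :: "complex^'n^'n"
    by (simp add: adjoint_mat_def vec_eq_iff)
  have Ey: "adjoint_mat (E k) *v y m = 0" if "m \<noteq> k" for m k
  proof (rule kill[OF that, of "y m" "\<lambda>m. adjoint_mat (E m)"])
    show "norm (adjoint_mat (E m) *v y m) = 1" by (simp add: Estar nx)
    show "opnorm (adjoint_mat (E m) + adjoint_mat (E k)) \<le> 1"
      using opnorm_adjoint_le[of "E m + E k"] plus[OF that] by (simp add: adjoint_mat_add)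
    show "opnorm (adjoint_mat (E m) - adjoint_mat (E k)) \<le> 1"
      using opnorm_adjoint_le[of "E m - E k"] minus[OF that] by (simp add: adj_diff)
  qed (rule ny)
  define X :: "complex^'n^'n" where "X = (\<chi> i j. x j $ i)"
  define Y :: "complex^'n^'n" where "Y = (\<chi> i j. y j $ i)"
  have colX: "column j X = x j" and colY: "column j Y = y j" for j
    by (simp_all add: X_def Y_def column_def)
  have X: "unitary_mat X"
  proof (rule unitary_columns)
    fix i j :: 'n
    assume "i \<noteq> j"
    then have "E i *v x j = 0" by (intro Ex) simp
    \<comment> \<open>Writing x_i as E_i* y_i moves E_i over to x_j, where it vanishes.\<close>
    moreover have "cip (x i) (x j) = cip (y i) (E i *v x j)"
      using cip_adjoint[of "adjoint_mat (E i)" "y i" "x j"] by (simp add: Estar)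
    ultimately show "cip (column i X) (column j X) = 0" by (simp add: colX cip_def)
  qed (simp add: colX nx)
  have Y: "unitary_mat Y"
  proof (rule unitary_columns)
    fix i j :: 'n
    assume "i \<noteq> j"
    then have "adjoint_mat (E i) *v y j = 0" by (intro Ey) simp
    moreover have "cip (y i) (y j) = cip (x i) (adjoint_mat (E i) *v y j)"
      by (simp add: cip_adjoint[symmetric] y_def)
    ultimately show "cip (column i Y) (column j Y) = 0" by (simp add: colY cip_def)
  qed (simp add: colY ny)
  have "E m ** X = Y ** cdiag (\<lambda>j. if j = m then 1 else 0)" for m
  proof (rule matrix_eq_columns)
    fix j
    have "column j (Y ** cdiag (\<lambda>j. if j = m then 1 else 0)) = (if j = m then y m else 0)"
      by (simp add: vec_eq_iff column_def Y_def matrix_matrix_mult_def cdiag_def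
          if_distrib[of "\<lambda>x. _ * x"] sum.delta cong: if_cong)
    then show "column j (E m ** X) = column j (Y ** cdiag (\<lambda>j. if j = m then 1 else 0))"
      by (simp add: column_mult colX y_def Ex)
  qed
  then have "E m = Y ** cdiag (\<lambda>j. if j = m then 1 else 0) ** adjoint_mat X" for m
    using X unfolding unitary_mat_def by (metis matrix_mul_assoc matrix_mul_rid)
  with X Y that show ?thesis by blast
qed

subsection \<open>Toeplitz and circulant matrices\<close>

lemma idx_rank_less: "idx_rank (i :: 'n::{finite,linorder}) < CARD('n)"
  unfolding idx_rank_def by (intro psubset_card_mono) auto

lemma idx_rank_eq_iff: "idx_rank (i :: 'n::{finite,linorder}) = idx_rank j \<longleftrightarrow> i = j"
proof -
  have "idx_rank i < idx_rank j" if "i < j" for i j :: 'n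
    unfolding idx_rank_def using that by (intro psubset_card_mono) auto
  then show ?thesis
    by (metis less_irrefl linorder_less_linear)
qed

lemma bij_idx_rank: "bij_betw (idx_rank :: 'n::{finite,linorder} \<Rightarrow> nat) UNIV {..<CARD('n)}"
proof -
  have inj: "inj (idx_rank :: 'n \<Rightarrow> nat)"
    by (simp add: inj_def idx_rank_eq_iff)
  then have "card (range (idx_rank :: 'n \<Rightarrow> nat)) = card {..<CARD('n)}"
    by (simp add: card_image)
  then have "range (idx_rank :: 'n \<Rightarrow> nat) = {..<CARD('n)}"
    by (intro card_subset_eq) (auto simp: idx_rank_less)
  with inj show ?thesis by (simp add: bij_betw_def)
qed

lemma obtain_idx_rank:
  assumes "k < CARD('n)"
  obtains i :: "'n::{finite,linorder}" where "idx_rank i = k"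
proof -
  have "k \<in> range (idx_rank :: 'n \<Rightarrow> nat)"
    using assms bij_idx_rank[where 'n = 'n] by (simp add: bij_betw_def)
  then show ?thesis using that by (auto simp: image_iff)
qed

definition shift :: "int \<Rightarrow> complex^('n::{finite,linorder})^('n::{finite,linorder})" where
  "shift k = (\<chi> i j. if int (idx_rank i) - int (idx_rank j) = k then 1 else 0)"

lemma toeplitz_shift: "toeplitz (shift k)"
  by (simp add: toeplitz_def shift_def)

lemma toeplitzD:
  "toeplitz T \<Longrightarrow> int (idx_rank i) - int (idx_rank j) = int (idx_rank k) - int (idx_rank l)
    \<Longrightarrow> T$i$j = T$k$l"
  unfolding toeplitz_def by blast

lemma toeplitz_add:
  assumes "toeplitz A" "toeplitz B"
  shows "toeplitz (A + B)"
  unfolding toeplitz_def vector_add_component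
  by (intro allI impI arg_cong2[where f = "(+)"] toeplitzD assms)

lemma toeplitz_scale:
  assumes "toeplitz A"
  shows "toeplitz (cmat_scale c A)"
  unfolding toeplitz_def cmat_scale_def vec_lambda_beta
  by (intro allI impI arg_cong2[where f = "(*)"] toeplitzD assms refl)

lemma toeplitz_0: "toeplitz 0"
  by (simp add: toeplitz_def)

lemma toeplitz_sum: "(\<And>a. a \<in> S \<Longrightarrow> toeplitz (f a)) \<Longrightarrow> toeplitz (\<Sum>a\<in>S. f a)"
  by (induction S rule: infinite_finite_induct) (auto simp: toeplitz_0 intro: toeplitz_add)

lemma shift_0: "shift 0 = mat 1"
  by (auto simp: shift_def mat_def vec_eq_iff idx_rank_eq_iff)

lemma shift_eq_0:
  assumes "int (CARD('n)) \<le> \<bar>k\<bar>"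
  shows "(shift k :: complex^('n::{finite,linorder})^('n::{finite,linorder})) = 0"
proof -
  have "int (idx_rank i) - int (idx_rank j) \<noteq> k" for i j :: 'n
    using assms idx_rank_less[of i] idx_rank_less[of j] by linarith
  then show ?thesis by (simp add: shift_def vec_eq_iff)
qed

lemma adjoint_shift: "adjoint_mat (shift k) = shift (- k)"
  by (auto simp: adjoint_mat_def shift_def vec_eq_iff)

lemma toeplitz_expand:
  fixes T :: "complex^('n::{finite,linorder})^('n::{finite,linorder})"
  assumes "toeplitz T"
  obtains t where "T = (\<Sum>k\<in>{- int CARD('n)..int CARD('n)}. cmat_scale (t k) (shift k))"
proof -
  define d where "d p = int (idx_rank (fst p)) - int (idx_rank (snd p))" for p :: "'n \<times> 'n"
  \<comment> \<open>For k = n and k = -n no pair of indices has difference k and the choice is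
    arbitrary; this is harmless because \<open>shift k\<close> is 0 there.\<close>
  define t where "t k = (let p = SOME p. d p = k in T $ fst p $ snd p)" for k
  have t: "T$i$j = t (int (idx_rank i) - int (idx_rank j))" for i j
  proof -
    have "d (SOME p. d p = d (i, j)) = d (i, j)"
      by (rule someI) (rule refl)
    then have "T$i$j = t (d (i, j))"
      unfolding t_def Let_def
      by (intro toeplitzD[OF assms]) (simp add: d_def)
    then show ?thesis by (simp add: d_def)
  qed
  have "T = (\<Sum>k\<in>{- int CARD('n)..int CARD('n)}. cmat_scale (t k) (shift k))"
  proof -
    have "int (idx_rank i) - int (idx_rank j) \<in> {- int CARD('n)..int CARD('n)}" for i j :: 'n
      using idx_rank_less[of i] idx_rank_less[of j] by simp
    then show ?thesis
      by (simp add: vec_eq_iff t cmat_scale_def shift_def if_distrib[of "\<lambda>x. _ * x"] sum.delta cong: if_cong)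
  qed
  then show ?thesis by (rule that)
qed

section \<open>Generalized circulant matrices\<close>

definition node :: "complex \<Rightarrow> 'n::{finite,linorder} \<Rightarrow> complex" where
  "node z m = z * cis (2 * pi * real (idx_rank m) / real CARD('n))"

definition fourier :: "complex \<Rightarrow> complex^('n::{finite,linorder})^('n::{finite,linorder})" where
  "fourier z = (\<chi> i m. of_real (1 / sqrt (real CARD('n))) * cnj (node z m) ^ idx_rank i)"

text \<open>For |z| = 1 the columns of \<open>fourier z\<close> are an orthonormal eigenbasis with
  eigenvalues \<open>c m\<close>. The case z = 1 gives the ordinary circulants; in general the
  wrapped part of a diagonal carries the factor z^n.\<close>

definition circulant :: "complex \<Rightarrow> ('n \<Rightarrow> complex) \<Rightarrow> complex^('n::{finite,linorder})^('n::{finite,linorder})" where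
  "circulant z c = fourier z ** cdiag c ** adjoint_mat (fourier z)"

lemma norm_node: "cmod z = 1 \<Longrightarrow> cmod (node z m) = 1"
  by (simp add: node_def norm_mult)

lemma mult_regroup: "a * u * c * (a * v) = a * a * (c * (u * v))" for a u c v :: complex
  by (simp only: mult_ac)

text \<open>On the unit circle conjugation is inversion, so the two Fourier factors merge into one
  power, possibly negative, whose exponent depends only on the difference of the indices. This is
  why circulants are Toeplitz.\<close>

lemma circulant_entry:
  fixes c :: "'n::{finite,linorder} \<Rightarrow> complex"
  assumes z: "cmod z = 1"
  shows "circulant z c $ i $ j
    = (\<Sum>m\<in>UNIV. c m * node z m powi (int (idx_rank j) - int (idx_rank i))) / of_nat CARD('n)"
proof -
  have "cnj (node z m) ^ idx_rank i * node z m ^ idx_rank j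
      = node z m powi (int (idx_rank j) - int (idx_rank i))" for m :: 'n
  proof -
    have n0: "node z m \<noteq> 0" using norm_node[OF z, of m] by auto
    have "node z m * cnj (node z m) = 1"
      using norm_node[OF z, of m] by (simp add: complex_norm_square[symmetric])
    then have "cnj (node z m) = inverse (node z m)"
      using n0 by (simp add: field_simps)
    then have "cnj (node z m) ^ idx_rank i = inverse (node z m ^ idx_rank i)"
      by (simp add: power_inverse)
    then show ?thesis
      using n0 by (simp add: power_int_diff divide_inverse mult.commute)
  qed
  moreover have "complex_of_real (1 / sqrt (real CARD('n))) * complex_of_real (1 / sqrt (real CARD('n)))
      = 1 / of_nat CARD('n)"
    by (simp flip: of_real_mult)
  ultimately have "of_real (1 / sqrt (real CARD('n))) * cnj (node z m) ^ idx_rank i * c m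
        * (of_real (1 / sqrt (real CARD('n))) * node z m ^ idx_rank j)
      = c m * node z m powi (int (idx_rank j) - int (idx_rank i)) / of_nat CARD('n)" for m :: 'n
    using mult_regroup[of "of_real (1 / sqrt (real CARD('n)))" "cnj (node z m) ^ idx_rank i" "c m"
        "node z m ^ idx_rank j"]
    by (simp only: times_divide_eq_left mult_1)
  then show ?thesis
    by (simp add: circulant_def mult_cdiag_entry fourier_def adjoint_mat_def sum_divide_distrib)
qed

lemma toeplitz_circulant:
  assumes z: "cmod z = 1"
  shows "toeplitz (circulant z c)"
  unfolding toeplitz_def
proof (intro allI impI)
  fix i j k l :: 'a
  assume "int (idx_rank i) - int (idx_rank j) = int (idx_rank k) - int (idx_rank l)"
  then have "int (idx_rank j) - int (idx_rank i) = int (idx_rank l) - int (idx_rank k)"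
    by linarith
  then show "circulant z c $ i $ j = circulant z c $ k $ l"
    by (simp only: circulant_entry[OF z])
qed

text \<open>Up to the factor \<open>z powi e\<close> this is a geometric sum in the n-th root of
  unity x = exp(2 pi i e / n), and x = 1 exactly when n divides e.\<close>

lemma sum_node_powi:
  assumes z: "z \<noteq> 0"
  shows "(\<Sum>m\<in>(UNIV :: 'n::{finite,linorder} set). node z m powi e)
    = (if int CARD('n) dvd e then of_nat CARD('n) * z powi e else 0)"
proof -
  let ?n = "real CARD('n)"
  define x where "x = cis (2 * pi * real_of_int e / ?n)"
  have "node z m powi e = z powi e * x ^ idx_rank m" for m :: 'n
  proof -
    have "real_of_int e * (2 * pi * real (idx_rank m) / ?n)
        = real (idx_rank m) * (2 * pi * real_of_int e / ?n)"
      by (simp only: times_divide_eq_right mult_ac)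
    then show ?thesis
      by (simp only: node_def x_def power_int_mult_distrib cis_power_int Complex.DeMoivre)
  qed
  then have "(\<Sum>m\<in>(UNIV :: 'n set). node z m powi e) = z powi e * (\<Sum>m\<in>(UNIV :: 'n set). x ^ idx_rank m)"
    by (simp add: sum_distrib_left)
  also have "(\<Sum>m\<in>(UNIV :: 'n set). x ^ idx_rank m) = (\<Sum>r<CARD('n). x ^ r)"
    by (rule sum.reindex_bij_betw[OF bij_idx_rank])
  also have "\<dots> = (if int CARD('n) dvd e then of_nat CARD('n) else 0)"
  proof (cases "int CARD('n) dvd e")
    case True
    then obtain q where "e = int CARD('n) * q" by (elim dvdE)
    then have "2 * pi * real_of_int e / ?n = 2 * pi * real_of_int q"
      by simp
    then have "x = 1"
      by (simp only: x_def cis_multiple_2pi Ints_of_int)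
    with True show ?thesis by simp
  next
    case False
    have "x \<noteq> 1"
    proof
      assume "x = 1"
      then have "cos (2 * pi * real_of_int e / ?n) = 1"
        by (metis x_def cis.sel(1) one_complex.sel(1))
      then obtain q :: int where "2 * pi * real_of_int e / ?n = of_int q * 2 * pi"
        using cos_one_2pi_int by blast
      then have "real_of_int e * (2 * pi) = real_of_int (int CARD('n) * q) * (2 * pi)"
        by (simp add: divide_eq_eq mult_ac)
      then have "real_of_int e = real_of_int (int CARD('n) * q)"
        by simp
      then have "e = int CARD('n) * q"
        by (simp only: of_int_eq_iff)
      with False show False by simp
    qed
    moreover have "x ^ CARD('n) = 1"
    proof -
      have "?n * (2 * pi * real_of_int e / ?n) = 2 * pi * real_of_int e"
        by simp
      then show ?thesis
        by (simp only: x_def Complex.DeMoivre cis_multiple_2pi Ints_of_int)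
    qed
    ultimately show ?thesis
      using False by (simp add: sum_gp_strict)
  qed
  finally show ?thesis by auto
qed

text \<open>By \<open>sum_node_powi\<close> an entry on diagonal d survives only if n divides k - d,
  which leaves d = k and the wrapped diagonal d = k - n. Only z^n enters, so coefficients in l = z^n
  can be compared.\<close>

lemma circulant_power:
  assumes z: "cmod z = 1" and k: "k \<le> CARD('n)"
  shows "circulant z (\<lambda>m::'n::{finite,linorder}. node z m ^ k)
    = shift (int k) + cmat_scale (z ^ CARD('n)) (shift (int k - int CARD('n)))"
proof -
  let ?n = "int CARD('n)"
  have z0: "z \<noteq> 0" using z by auto
  have "circulant z (\<lambda>m::'n. node z m ^ k) $ i $ j
      = (shift (int k) + cmat_scale (z ^ CARD('n)) (shift (int k - ?n))) $ i $ j" for i j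
  proof -
    define e where "e = int k - (int (idx_rank i) - int (idx_rank j))"
    have "node z m ^ k * node z m powi (int (idx_rank j) - int (idx_rank i)) = node z m powi e" for m :: 'n
    proof -
      have "node z m \<noteq> 0" using norm_node[OF z, of m] by auto
      then have "node z m powi (int k + (int (idx_rank j) - int (idx_rank i)))
          = node z m powi int k * node z m powi (int (idx_rank j) - int (idx_rank i))"
        by (intro power_int_add) simp
      moreover have "e = int k + (int (idx_rank j) - int (idx_rank i))"
        by (simp add: e_def)
      ultimately show ?thesis by simp
    qed
    then have "circulant z (\<lambda>m::'n. node z m ^ k) $ i $ j = (if ?n dvd e then z powi e else 0)"
      by (simp add: circulant_entry[OF z] sum_node_powi[OF z0])
    moreover have "?n dvd e \<longleftrightarrow> e = 0 \<or> e = ?n"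
    proof
      assume "?n dvd e"
      then obtain q where q: "e = ?n * q" by (elim dvdE)
      \<comment> \<open>From 0 \<le> k \<le> n and index differences below n in modulus; the only
        multiples of n in this range are 0 and n.\<close>
      have "- ?n < e" "e < 2 * ?n"
        using idx_rank_less[of i] idx_rank_less[of j] k unfolding e_def by linarith+
      then have "?n * (- 1) < ?n * q" "?n * q < ?n * 2"
        using q by auto
      moreover have "0 < ?n" by simp
      ultimately have "- 1 < q" "q < 2"
        by (simp_all only: mult_less_cancel_left_pos)
      then show "e = 0 \<or> e = ?n" using q by (cases "q = 0") auto
    qed auto
    moreover have "?n \<noteq> 0" by simp
    ultimately show ?thesis
      by (auto simp: shift_def cmat_scale_def e_def)
  qed
  then show ?thesis by (simp add: vec_eq_iff)
qed

lemma circulant_1: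
  assumes "cmod z = 1"
  shows "circulant z (\<lambda>_. 1) = mat 1"
  using circulant_power[OF assms, of 0]
  by (simp add: shift_0 shift_eq_0 cmat_scale_def vec_eq_iff)

text \<open>The constant diagonal 1 turns a circulant into
  \<open>fourier z ** adjoint_mat (fourier z)\<close>, so \<open>circulant_1\<close> supplies a
  right inverse, which for square matrices is two-sided.\<close>

lemma unitary_fourier:
  assumes "cmod z = 1"
  shows "unitary_mat (fourier z)"
  using circulant_1[OF assms] by (simp add: circulant_def cdiag_1 unitary_mat_def matrix_left_right_inverse)

lemma adjoint_circulant: "adjoint_mat (circulant z c) = circulant z (\<lambda>m. cnj (c m))"
  by (simp add: circulant_def adjoint_mat_mult adjoint_mat_cdiag matrix_mul_assoc)

subsection \<open>Isometries on Toeplitz matrices\<close>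

lemma constant_coefficient:
  fixes A B C D P Q :: "complex^'n^'n"
  assumes "\<And>l. cmod l = 1 \<Longrightarrow>
    (A + cmat_scale l B) ** (C + cmat_scale l D) = P + cmat_scale l Q"
  shows "A ** C = P"
proof -
  have expand: "(A + cmat_scale l B) ** (C + cmat_scale l D)
      = A ** C + cmat_scale l (A ** D + B ** C) + cmat_scale (l\<^sup>2) (B ** D)" for l
    by (simp add: vec_eq_iff matrix_matrix_mult_def cmat_scale_def sum_distrib_left
        sum.distrib algebra_simps power2_eq_square)
  have "(A ** C)$i$j = P$i$j" for i j
  proof -
    have *: "(A ** C)$i$j + l * (A ** D + B ** C)$i$j + l\<^sup>2 * (B ** D)$i$j = P$i$j + l * Q$i$j"
      if "cmod l = 1" for l
      using assms[OF that] unfolding expand by (simp add: vec_eq_iff cmat_scale_def)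
    show ?thesis
      \<comment> \<open>Averaging over the four fourth roots of unity kills the terms in l and
        l^2.\<close>
      using *[of 1] *[of "- 1"] *[of \<i>] *[of "- \<i>"]
      by (simp add: complex_eq_iff)
  qed
  then show ?thesis by (simp add: vec_eq_iff)
qed

text \<open>The parameter is conjugated because this serves identities between adjoints.\<close>

lemma constant_coefficient_linear:
  fixes A B C D :: "complex^'n^'m"
  assumes "\<And>l. cmod l = 1 \<Longrightarrow> A + cmat_scale (cnj l) B = C + cmat_scale (cnj l) D"
  shows "A = C"
proof -
  have "A$i$j = C$i$j" for i j
  proof -
    have *: "A$i$j + cnj l * B$i$j = C$i$j + cnj l * D$i$j" if "cmod l = 1" for l
      using assms[OF that] by (simp add: vec_eq_iff cmat_scale_def)
    show ?thesis
      using *[of 1] *[of "- 1"] by (simp add: complex_eq_iff)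
  qed
  then show ?thesis by (simp add: vec_eq_iff)
qed

lemma cmat_scale_0: "cmat_scale 0 A = 0"
  by (simp add: cmat_scale_def vec_eq_iff)

text \<open>Lets z^n run over the whole unit circle, as comparing coefficients in l = z^n
  requires.\<close>

lemma unit_root:
  assumes "cmod l = 1" "n > 0"
  obtains z where "cmod z = 1" "z ^ n = l"
proof
  show "cmod (cis (Arg l / real n)) = 1" by simp
  have "real n * (Arg l / real n) = Arg l" using assms by simp
  then have "cis (Arg l / real n) ^ n = cis (Arg l)"
    by (simp only: Complex.DeMoivre)
  also have "cis (Arg l) = l"
  proof -
    have "l \<noteq> 0" using assms by auto
    then show ?thesis using assms by (simp add: cis_Arg Complex.sgn_eq)
  qed
  finally show "cis (Arg l / real n) ^ n = l" .
qed

text \<open>\<open>\<phi>\<close> is a total function unconstrained off the Toeplitz matrices, so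
  each use of linearity carries a Toeplitz side condition.\<close>

locale toeplitz_isometry =
  fixes \<phi> :: "complex^('n::{finite,linorder})^('n::{finite,linorder})
    \<Rightarrow> complex^('n::{finite,linorder})^('n::{finite,linorder})"
  assumes add: "\<And>A B. toeplitz A \<Longrightarrow> toeplitz B \<Longrightarrow> \<phi> (A + B) = \<phi> A + \<phi> B"
    and scale: "\<And>c A. toeplitz A \<Longrightarrow> \<phi> (cmat_scale c A) = cmat_scale c (\<phi> A)"
    and isom: "\<And>A. toeplitz A \<Longrightarrow> opnorm (\<phi> A) = opnorm A"
begin

lemma zero: "\<phi> 0 = 0"
  using scale[OF toeplitz_0, of 0] by (simp add: cmat_scale_0)

lemma sum:
  assumes "\<And>a. a \<in> S \<Longrightarrow> toeplitz (f a)"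
  shows "\<phi> (\<Sum>a\<in>S. f a) = (\<Sum>a\<in>S. \<phi> (f a))"
  using assms
  by (induction S rule: infinite_finite_induct) (simp_all add: zero add toeplitz_sum)

text \<open>The diagonals \<open>u m\<close> plus or minus \<open>u k\<close> have entries of
  modulus at most 1, so the images of the spectral projections satisfy the hypotheses of
  \<open>isometric_linfty_in_matrices\<close>. Both X and Y may depend on z.\<close>

lemma image_circulant:
  assumes z: "cmod z = 1"
  obtains X Y where "unitary_mat X" "unitary_mat Y"
    "\<And>c. \<phi> (circulant z c) = Y ** cdiag c ** adjoint_mat X"
proof -
  define u :: "'n \<Rightarrow> 'n \<Rightarrow> complex" where "u m j = (if j = m then 1 else 0)" for m j
  define E where "E m = \<phi> (circulant z (u m))" for m
  note T = toeplitz_circulant[OF z]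
  have le: "opnorm (\<phi> (circulant z c)) \<le> 1" if "\<And>m. cmod (c m) \<le> 1" for c
  proof -
    have "opnorm (circulant z c) \<le> 1"
      unfolding circulant_def by (intro opnorm_conj_cdiag_le unitary_fourier z that)
    then show ?thesis by (simp add: isom T)
  qed
  have "opnorm (circulant z (u m)) = 1" for m
    unfolding circulant_def u_def[abs_def] by (intro opnorm_conj_cdiag_unit unitary_fourier z)
  then have "opnorm (E m) = 1" for m
    by (simp add: E_def isom T)
  moreover have "opnorm (E m + E k) \<le> 1" if "m \<noteq> k" for m k
  proof -
    have "E m + E k = \<phi> (circulant z (\<lambda>j. u m j + u k j))"
      by (simp add: E_def circulant_def mult_cdiag_add add T[unfolded circulant_def])
    then show ?thesis using le that by (simp add: u_def)
  qed
  moreover have "opnorm (E m - E k) \<le> 1" if "m \<noteq> k" for m k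
  proof -
    \<comment> \<open>Only sums and scalar multiples are available for \<open>\<phi>\<close>, so the
      difference is first written with the scalar -1.\<close>
    have "E m + cmat_scale (- 1) (E k) = \<phi> (circulant z (\<lambda>j. u m j + (- 1) * u k j))"
      unfolding circulant_def mult_cdiag_add mult_cdiag_scale
      by (simp add: E_def circulant_def add scale toeplitz_scale T[unfolded circulant_def])
    moreover have "E m + cmat_scale (- 1) (E k) = E m - E k"
      by (simp add: cmat_scale_def vec_eq_iff)
    ultimately show ?thesis using le that by (simp add: u_def)
  qed
  ultimately obtain X Y where X: "unitary_mat X" and Y: "unitary_mat Y"
    and E: "\<And>m. E m = Y ** cdiag (u m) ** adjoint_mat X"
    using isometric_linfty_in_matrices[of E] unfolding u_def[abs_def] by metis
  have "\<phi> (circulant z c) = Y ** cdiag c ** adjoint_mat X" for c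
  proof -
    have "circulant z c = (\<Sum>m\<in>UNIV. cmat_scale (c m) (circulant z (u m)))"
      unfolding circulant_def u_def[abs_def] by (rule mult_cdiag_expand)
    then have "\<phi> (circulant z c) = (\<Sum>m\<in>UNIV. cmat_scale (c m) (E m))"
      by (simp add: sum toeplitz_scale T scale E_def)
    also have "\<dots> = Y ** cdiag c ** adjoint_mat X"
      unfolding E u_def[abs_def] by (rule mult_cdiag_expand[symmetric])
    finally show ?thesis .
  qed
  with X Y show ?thesis by (rule that)
qed

section \<open>Normalization to a unital map\<close>

lemma unitary_image_1: "unitary_mat (\<phi> (mat 1))"
proof -
  obtain X Y where "unitary_mat X" "unitary_mat Y"
    "\<And>c. \<phi> (circulant 1 c) = Y ** cdiag c ** adjoint_mat X"
    using image_circulant[of 1] by auto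
  moreover have "circulant 1 (\<lambda>_::'n. 1) = mat 1"
    by (rule circulant_1) simp
  ultimately show ?thesis
    by (metis cdiag_1 matrix_mul_rid norm_one unitary_adjoint unitary_mult)
qed

definition \<psi> where
  "\<psi> T = adjoint_mat (\<phi> (mat 1)) ** \<phi> T"

lemma \<psi>_add: "toeplitz A \<Longrightarrow> toeplitz B \<Longrightarrow> \<psi> (A + B) = \<psi> A + \<psi> B"
  by (simp add: \<psi>_def add matrix_add_ldistrib)

lemma \<psi>_scale: "toeplitz A \<Longrightarrow> \<psi> (cmat_scale c A) = cmat_scale c (\<psi> A)"
  by (simp add: \<psi>_def scale matrix_scale_right)

lemma \<psi>_0: "\<psi> 0 = 0"
  by (simp add: \<psi>_def zero)

text \<open>Whatever z is, Y X* equals \<open>\<phi> (mat 1)\<close>. Multiplying by its adjoint X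
  Y* turns the left factor Y into X, and what remains is conjugation by one unitary, hence a
  *-homomorphism on the circulants of z.\<close>

lemma \<psi>_circulant:
  assumes z: "cmod z = 1"
  obtains X where "unitary_mat X" "\<And>c. \<psi> (circulant z c) = X ** cdiag c ** adjoint_mat X"
proof -
  obtain X Y where X: "unitary_mat X" and Y: "unitary_mat Y"
    and E: "\<And>c. \<phi> (circulant z c) = Y ** cdiag c ** adjoint_mat X"
    by (rule image_circulant[OF z]) (rule that)
  have "\<phi> (mat 1) = Y ** adjoint_mat X"
    using E[of "\<lambda>_. 1"] by (simp add: circulant_1[OF z] cdiag_1)
  then have "\<psi> (circulant z c) = X ** (adjoint_mat Y ** Y) ** cdiag c ** adjoint_mat X" for c
    by (simp add: \<psi>_def E adjoint_mat_mult matrix_mul_assoc)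
  then have "\<psi> (circulant z c) = X ** cdiag c ** adjoint_mat X" for c
    using Y by (simp add: unitary_mat_def)
  with X show ?thesis by (rule that)
qed

lemma \<psi>_circulant_mult:
  assumes z: "cmod z = 1"
  shows "\<psi> (circulant z c) ** \<psi> (circulant z d) = \<psi> (circulant z (\<lambda>m. c m * d m))"
proof -
  obtain X where X: "unitary_mat X"
    and E: "\<And>c. \<psi> (circulant z c) = X ** cdiag c ** adjoint_mat X"
    by (rule \<psi>_circulant[OF z]) (rule that)
  have "\<psi> (circulant z c) ** \<psi> (circulant z d)
      = X ** cdiag c ** (adjoint_mat X ** X) ** cdiag d ** adjoint_mat X"
    by (simp add: E matrix_mul_assoc)
  also have "\<dots> = X ** (cdiag c ** cdiag d) ** adjoint_mat X"
    using X by (simp add: unitary_mat_def matrix_mul_assoc)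
  finally show ?thesis by (simp add: E cdiag_mult)
qed

lemma \<psi>_circulant_adjoint:
  assumes z: "cmod z = 1"
  shows "\<psi> (adjoint_mat (circulant z c)) = adjoint_mat (\<psi> (circulant z c))"
proof -
  obtain X where E: "\<And>c. \<psi> (circulant z c) = X ** cdiag c ** adjoint_mat X"
    using \<psi>_circulant[OF z] by blast
  show ?thesis
    by (simp add: E adjoint_circulant adjoint_mat_mult adjoint_mat_cdiag matrix_mul_assoc)
qed

section \<open>Images of the powers of the shift\<close>

lemma \<psi>_circulant_power:
  assumes "cmod z = 1" "k \<le> CARD('n)"
  shows "\<psi> (circulant z (\<lambda>m. node z m ^ k))
    = \<psi> (shift (int k)) + cmat_scale (z ^ CARD('n)) (\<psi> (shift (int k - int CARD('n))))"
  by (simp add: circulant_power assms \<psi>_add \<psi>_scale toeplitz_shift toeplitz_scale)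

text \<open>Apply multiplicativity to node^1 * node^k = node^(k+1) and compare the terms constant in
  l = z^n. The case k = n - 1 is still covered and yields A^n = 0 for A =
  \<open>\<psi> (shift 1)\<close>.\<close>

lemma \<psi>_shift_Suc: "\<psi> (shift (int (Suc k))) = \<psi> (shift 1) ** \<psi> (shift (int k))"
proof (cases "k < CARD('n)")
  case True
  show ?thesis
  proof (rule constant_coefficient[symmetric])
    fix l :: complex
    assume "cmod l = 1"
    then obtain z where z: "cmod z = 1" and l: "z ^ CARD('n) = l"
      by (rule unit_root[of l "CARD('n)"]) simp_all
    have "\<psi> (circulant z (\<lambda>m. node z m ^ 1)) ** \<psi> (circulant z (\<lambda>m. node z m ^ k))
        = \<psi> (circulant z (\<lambda>m. node z m ^ Suc k))"
      by (simp add: \<psi>_circulant_mult[OF z])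
    moreover have "1 \<le> CARD('n)" "k \<le> CARD('n)" "Suc k \<le> CARD('n)"
      using True by simp_all
    ultimately show "(\<psi> (shift 1) + cmat_scale l (\<psi> (shift (1 - int CARD('n)))))
        ** (\<psi> (shift (int k)) + cmat_scale l (\<psi> (shift (int k - int CARD('n)))))
        = \<psi> (shift (int (Suc k))) + cmat_scale l (\<psi> (shift (int (Suc k) - int CARD('n))))"
      using z by (simp only: \<psi>_circulant_power l of_nat_1)
  qed
next
  case False
  then show ?thesis by (simp add: shift_eq_0 \<psi>_0)
qed

lemma \<psi>_shift_0: "\<psi> (shift 0) = mat 1"
  using unitary_image_1 by (simp add: \<psi>_def shift_0 unitary_mat_def)

lemma \<psi>_shift_add: "\<psi> (shift (int (j + k))) = \<psi> (shift (int j)) ** \<psi> (shift (int k))"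
proof (induction j)
  case (Suc j)
  have "\<psi> (shift (int (Suc j + k))) = \<psi> (shift 1) ** \<psi> (shift (int (j + k)))"
    using \<psi>_shift_Suc[of "j + k"] by simp
  also have "\<dots> = \<psi> (shift (int (Suc j))) ** \<psi> (shift (int k))"
    by (simp only: Suc.IH \<psi>_shift_Suc matrix_mul_assoc)
  finally show ?case .
qed (simp add: \<psi>_shift_0)

text \<open>\<open>\<psi>\<close> respects adjoints of circulants; taking the adjoint of node^k
  conjugates l, and the terms constant in the conjugate of l give the claim.\<close>

lemma \<psi>_shift_uminus:
  assumes "k \<le> CARD('n)"
  shows "\<psi> (shift (- int k)) = adjoint_mat (\<psi> (shift (int k)))"
proof -
  let ?n = "int CARD('n)"
  have *: "\<psi> (shift (- int k)) + cmat_scale (cnj l) (\<psi> (shift (- (int k - ?n))))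
      = adjoint_mat (\<psi> (shift (int k))) + cmat_scale (cnj l) (adjoint_mat (\<psi> (shift (int k - ?n))))"
    if l1: "cmod l = 1" for l
  proof -
    obtain z where z: "cmod z = 1" and l: "z ^ CARD('n) = l"
      using l1 by (rule unit_root[of l "CARD('n)"]) simp_all
    have "adjoint_mat (circulant z (\<lambda>m::'n. node z m ^ k))
        = shift (- int k) + cmat_scale (cnj l) (shift (- (int k - ?n)))"
      by (simp only: circulant_power[OF z assms] l adjoint_mat_add adjoint_mat_scale adjoint_shift)
    then show ?thesis
      using \<psi>_circulant_adjoint[OF z, of "\<lambda>m. node z m ^ k"]
      by (simp only: \<psi>_circulant_power[OF z assms] l adjoint_mat_add adjoint_mat_scale
          \<psi>_add \<psi>_scale toeplitz_shift toeplitz_scale)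
  qed
  show ?thesis
    using * by (rule constant_coefficient_linear)
qed

section \<open>Norm estimates and a cyclic vector\<close>

lemma opnorm_\<psi>:
  assumes "toeplitz T"
  shows "opnorm (\<psi> T) = opnorm T"
proof -
  have "norm (\<psi> T *v x) = norm (\<phi> T *v x)" for x
    by (simp add: \<psi>_def matrix_vector_mul_assoc[symmetric] norm_unitary unitary_adjoint unitary_image_1)
  then have "opnorm (\<psi> T) = opnorm (\<phi> T)"
    by (simp add: opnorm_def onorm_def)
  then show ?thesis by (simp add: isom assms)
qed

lemma \<psi>_shift_norm_le: "norm (\<psi> (shift (int k)) *v x) \<le> norm x"
proof (induction k)
  case 0
  then show ?case by (simp add: \<psi>_shift_0)
next
  case (Suc k)
  have contr: "norm (\<psi> (shift 1) *v y) \<le> norm y" for y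
  proof -
    let ?n = "int CARD('n)"
    let ?B = "\<psi> (shift (1 - ?n))"
    have *: "norm ((\<psi> (shift 1) + cmat_scale l ?B) *v y) \<le> norm y" if l1: "cmod l = 1" for l
    proof -
      obtain z where z: "cmod z = 1" and l: "z ^ CARD('n) = l"
        using l1 by (rule unit_root[of l "CARD('n)"]) simp_all
      have "opnorm (circulant z (\<lambda>m::'n. node z m ^ 1)) \<le> 1"
        unfolding circulant_def
        by (intro opnorm_conj_cdiag_le unitary_fourier z) (simp add: norm_node z)
      moreover have "\<psi> (circulant z (\<lambda>m. node z m ^ 1)) = \<psi> (shift 1) + cmat_scale l ?B"
        using \<psi>_circulant_power[OF z, of 1] by (simp add: l Suc_le_eq)
      ultimately have "opnorm (\<psi> (shift 1) + cmat_scale l ?B) \<le> 1"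
        using opnorm_\<psi>[OF toeplitz_circulant[OF z]] by metis
      then have "opnorm (\<psi> (shift 1) + cmat_scale l ?B) * norm y \<le> 1 * norm y"
        by (rule mult_right_mono) simp
      then show ?thesis
        using norm_mult_vec_le[of "\<psi> (shift 1) + cmat_scale l ?B" y] by simp
    qed
    \<comment> \<open>The image of the shift is the mean of the images of two unimodular circulants,
      l = 1 and l = -1, so it is a contraction.\<close>
    have "(\<psi> (shift 1) + cmat_scale 1 ?B) *v y + (\<psi> (shift 1) + cmat_scale (- 1) ?B) *v y
        = 2 *\<^sub>R (\<psi> (shift 1) *v y)"
      by (simp add: matrix_vector_mult_add_rdistrib matrix_scale_vec vec_eq_iff scaleR_2)
    then have "2 * norm (\<psi> (shift 1) *v y)
        = norm ((\<psi> (shift 1) + cmat_scale 1 ?B) *v y + (\<psi> (shift 1) + cmat_scale (- 1) ?B) *v y)"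
      by simp
    also have "\<dots> \<le> norm y + norm y"
      by (intro norm_triangle_mono *) simp_all
    finally show ?thesis by simp
  qed
  have "\<psi> (shift (int (Suc k))) *v x = \<psi> (shift 1) *v (\<psi> (shift (int k)) *v x)"
    by (simp only: \<psi>_shift_Suc matrix_vector_mul_assoc)
  then show ?case using contr Suc.IH order_trans by metis
qed

text \<open>Take x where the image of S^(n-1) attains its norm, which is at least 1. This image
  factors through A^k followed by the contraction A^(n-1-k), so no intermediate A^k x can have norm
  below 1.\<close>

lemma cyclic_vector:
  obtains x where "\<And>k. k < CARD('n) \<Longrightarrow> norm (\<psi> (shift (int k)) *v x) = 1"
proof -
  let ?N = "CARD('n) - 1"
  let ?S = "shift (int ?N) :: complex^('n::{finite,linorder})^('n::{finite,linorder})"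
  obtain x where x: "norm x = 1" and max: "norm (\<psi> ?S *v x) = opnorm (\<psi> ?S)"
    by (rule opnorm_attained)
  have N: "?N < CARD('n)" by simp
  obtain p :: 'n where p: "idx_rank p = ?N"
    using N by (rule obtain_idx_rank)
  obtain q :: 'n where q: "idx_rank q = 0"
    by (rule obtain_idx_rank[of 0]) simp_all
  \<comment> \<open>S^(n-1) carries the first basis vector to the last one, so its norm is at least
    1.\<close>
  have "(?S *v axis q 1)$p = 1"
    by (simp add: matrix_vector_mult_def axis_def shift_def p q if_distrib[of "\<lambda>x. _ * x"] cong: if_cong)
  then have "1 \<le> norm (?S *v axis q 1)"
    by (metis Finite_Cartesian_Product.norm_nth_le norm_one)
  also have "\<dots> \<le> opnorm ?S"
    using norm_mult_vec_le[of ?S "axis q 1"] by simp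
  finally have top: "1 \<le> norm (\<psi> ?S *v x)"
    by (simp only: max opnorm_\<psi>[OF toeplitz_shift])
  have "norm (\<psi> (shift (int k)) *v x) = 1" if "k < CARD('n)" for k
  proof (rule antisym)
    show "norm (\<psi> (shift (int k)) *v x) \<le> 1"
      using \<psi>_shift_norm_le[of k x] x by simp
    have "?N = (?N - k) + k" using that by simp
    then have "\<psi> ?S *v x = \<psi> (shift (int (?N - k))) *v (\<psi> (shift (int k)) *v x)"
      by (metis \<psi>_shift_add matrix_vector_mul_assoc)
    with top show "1 \<le> norm (\<psi> (shift (int k)) *v x)"
      using \<psi>_shift_norm_le[of "?N - k" "\<psi> (shift (int k)) *v x"] by simp
  qed
  then show ?thesis by (rule that)
qed

text \<open>The orbit v_k = A^k x, for k < n, is an orthonormal basis that A shifts and whose last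
  vector it kills. The unitary with these columns therefore intertwines S and A.\<close>

lemma \<psi>_unitary_conj:
  obtains U where "unitary_mat U" "\<And>T. toeplitz T \<Longrightarrow> \<psi> T = U ** T ** adjoint_mat U"
proof -
  obtain x where x: "\<And>k. k < CARD('n) \<Longrightarrow> norm (\<psi> (shift (int k)) *v x) = 1"
    by (rule cyclic_vector) (rule that)
  define v where "v k = \<psi> (shift (int k)) *v x" for k
  have nv: "norm (v k) = 1" if "k < CARD('n)" for k
    using x[OF that] by (simp add: v_def)
  have v0: "v k = 0" if "CARD('n) \<le> k" for k
    using that by (simp add: v_def shift_eq_0 \<psi>_0)
  have shift_v: "\<psi> (shift (int j)) *v v k = v (j + k)" for j k
    by (simp only: v_def \<psi>_shift_add matrix_vector_mul_assoc)
  have step_v: "\<psi> (shift 1) *v v k = v (Suc k)" for k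
    using shift_v[of 1 k] by simp
  \<comment> \<open>A is a contraction that preserves the norm of v_k, so the equality case applies:
    A* undoes A along the orbit.\<close>
  have back_v: "adjoint_mat (\<psi> (shift 1)) *v v (Suc k) = v k" if "Suc k < CARD('n)" for k
  proof -
    have "opnorm (\<psi> (shift 1)) \<le> 1"
      using \<psi>_shift_norm_le[of 1] by (intro opnorm_bound) simp_all
    then show ?thesis
      using adjoint_of_norm_attained[of "\<psi> (shift 1)" "v k"] that by (simp add: nv step_v)
  qed
  \<comment> \<open>Only j + m is kept below n; k + m may run past the end of the orbit, where
    \<open>v\<close> is 0.\<close>
  have cip_step: "cip (v j) (v k) = cip (v (j + m)) (v (k + m))" if "j + m < CARD('n)" for j k m
    using that
  proof (induction m)
    case (Suc m)
    then have "cip (v (j + m)) (v (k + m)) = cip (adjoint_mat (\<psi> (shift 1)) *v v (Suc (j + m))) (v (k + m))"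
      by (simp add: back_v)
    also have "\<dots> = cip (v (Suc (j + m))) (v (Suc (k + m)))"
      by (simp add: cip_adjoint step_v)
    finally show ?case using Suc by simp
  qed simp
  \<comment> \<open>The shift by m = n - k sends the second vector to v_n = 0 while the first index
    stays below n.\<close>
  have less: "cip (v j) (v k) = 0" if "j < k" "k < CARD('n)" for j k
  proof -
    have "cip (v j) (v k) = cip (v (j + (CARD('n) - k))) (v (k + (CARD('n) - k)))"
      using that by (intro cip_step) linarith
    then show ?thesis using that by (simp add: v0 cip_def)
  qed
  define U where "U = (\<chi> i. \<chi> j::'n. v (idx_rank j) $ i)"
  have colU: "column j U = v (idx_rank j)" for j
    by (simp add: U_def column_def)
  have U: "unitary_mat U"
  proof (rule unitary_columns)
    fix i j :: 'n
    assume "i \<noteq> j"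
    then have "idx_rank i < idx_rank j \<or> idx_rank j < idx_rank i"
      by (metis idx_rank_eq_iff linorder_neqE_nat)
    then show "cip (column i U) (column j U) = 0"
      unfolding colU using less[of "idx_rank i" "idx_rank j"] less[of "idx_rank j" "idx_rank i"]
        cip_commute[of "v (idx_rank i)" "v (idx_rank j)"] idx_rank_less[of i] idx_rank_less[of j]
      by auto
  qed (simp add: colU nv idx_rank_less)
  have pos: "\<psi> (shift (int k)) = U ** shift (int k) ** adjoint_mat U" for k
  proof -
    have "\<psi> (shift (int k)) ** U = U ** shift (int k)"
    proof (rule matrix_eq_columns)
      fix j :: 'n
      have "column j (U ** shift (int k)) = v (k + idx_rank j)"
      proof (cases "k + idx_rank j < CARD('n)")
        case True
        then obtain p :: 'n where p: "idx_rank p = k + idx_rank j"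
          by (rule obtain_idx_rank)
        have "(int (idx_rank i) - int (idx_rank j) = int k) = (i = p)" for i :: 'n
          using p by (metis add_diff_cancel_right' idx_rank_eq_iff diff_add_cancel of_nat_add of_nat_eq_iff)
        then have "column j (U ** shift (int k)) = column p U"
          by (simp add: column_def matrix_matrix_mult_def shift_def vec_eq_iff
              if_distrib[of "\<lambda>x. _ * x"] sum.delta' sum.delta cong: if_cong)
        then show ?thesis by (simp add: colU p)
      next
        case False
        then have "int (idx_rank i) - int (idx_rank j) \<noteq> int k" for i :: 'n
          using idx_rank_less[of i] by linarith
        then have "column j (U ** shift (int k)) = 0"
          by (simp add: column_def matrix_matrix_mult_def shift_def vec_eq_iff)
        then show ?thesis using False by (simp add: v0)
      qed
      then show "column j (\<psi> (shift (int k)) ** U) = column j (U ** shift (int k))"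
        by (simp add: column_mult colU shift_v)
    qed
    then show ?thesis
      using U unfolding unitary_mat_def by (metis matrix_mul_assoc matrix_mul_rid)
  qed
  \<comment> \<open>Negative diagonals follow by taking adjoints of the nonnegative ones.\<close>
  have all: "\<psi> (shift k) = U ** shift k ** adjoint_mat U"
    if "k \<in> {- int CARD('n)..int CARD('n)}" for k
  proof (cases "0 \<le> k")
    case True
    then show ?thesis using pos[of "nat k"] by simp
  next
    case False
    then have k: "k = - int (nat (- k))" and "nat (- k) \<le> CARD('n)"
      using that by auto
    then have "\<psi> (shift k) = adjoint_mat (\<psi> (shift (int (nat (- k)))))"
      using \<psi>_shift_uminus[of "nat (- k)"] by simp
    also have "\<dots> = U ** shift k ** adjoint_mat U"
      unfolding pos adjoint_mat_mult adjoint_shift using False by (simp add: matrix_mul_assoc)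
    finally show ?thesis .
  qed
  have "\<psi> T = U ** T ** adjoint_mat U" if T_toeplitz: "toeplitz T" for T
  proof -
    obtain t where T: "T = (\<Sum>k\<in>{- int CARD('n)..int CARD('n)}. cmat_scale (t k) (shift k))"
      using T_toeplitz by (rule toeplitz_expand)
    \<comment> \<open>Generalized to finite subsets \<open>K\<close> of the index range to allow
      induction.\<close>
    have "\<psi> (\<Sum>k\<in>K. cmat_scale (t k) (shift k))
        = U ** (\<Sum>k\<in>K. cmat_scale (t k) (shift k)) ** adjoint_mat U"
      if "finite K" "K \<subseteq> {- int CARD('n)..int CARD('n)}" for K
      using that
    proof (induction K)
      case empty
      then show ?case by (simp add: \<psi>_0)
    next
      case (insert k K)
      then show ?case
        by (simp add: \<psi>_add \<psi>_scale toeplitz_shift toeplitz_scale toeplitz_sum all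
            matrix_scale_right matrix_scale_left matrix_add_ldistrib matrix_add_rdistrib)
    qed
    then show ?thesis unfolding T by simp
  qed
  with U show ?thesis by (rule that)
qed

end

theorem theorem5p4:
  fixes \<phi> :: "complex^('n::{finite,linorder})^('n::{finite,linorder}) \<Rightarrow> complex^('n::{finite,linorder})^('n::{finite,linorder})"
  assumes add: "\<And>A B. toeplitz A \<Longrightarrow> toeplitz B \<Longrightarrow> \<phi> (A + B) = \<phi> A + \<phi> B"
    and scale: "\<And>c A. toeplitz A \<Longrightarrow> \<phi> (cmat_scale c A) = cmat_scale c (\<phi> A)"
    and isom: "\<And>A. toeplitz A \<Longrightarrow> opnorm (\<phi> A) = opnorm A"
  shows "\<exists>U V. unitary_mat U \<and> unitary_mat V \<and>
           (\<forall>T. toeplitz T \<longrightarrow> \<phi> T = U ** T ** V)"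
proof -
  interpret toeplitz_isometry \<phi>
    by unfold_locales (fact add scale isom)+
  obtain U where U: "unitary_mat U" and \<psi>: "\<And>T. toeplitz T \<Longrightarrow> \<psi> T = U ** T ** adjoint_mat U"
    by (rule \<psi>_unitary_conj) (rule that)
  \<comment> \<open>Undoing the normalization puts the unitary \<open>\<phi> (mat 1)\<close> into
    the left factor only.\<close>
  have "\<phi> T = (\<phi> (mat 1) ** U) ** T ** adjoint_mat U" if "toeplitz T" for T
  proof -
    have "\<phi> T = \<phi> (mat 1) ** \<psi> T"
      using unitary_image_1 by (simp add: \<psi>_def unitary_mat_def matrix_mul_assoc)
    then show ?thesis by (simp add: \<psi> that matrix_mul_assoc)
  qed
  with unitary_mult[OF unitary_image_1 U] unitary_adjoint[OF U] show ?thesis by blast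
qed

end
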